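(* Let $V\in C^1([0,1];\mathbb{R})$, $V_0=V(0)$, $V_1=V(1)$, $V_M=\max_{x\in[0,1]}V(x)$, and set $u_0^{\mathrm{crit}}=V_M-V_0$, $u_1^{\mathrm{crit}}=V_M-V_1$. For $u_0>0$ and $u_1>0$ consider the Dirichlet problem $$\frac{d}{dx}\left[u(x)\,\frac{d}{dx}\big(u(x)+V(x)\big)\right]=0,\quad x\in[0,1],\qquad u(0)=u_0,\quad u(1)=u_1. \qquad (P)$$ (1) If $u_0>u_0^{\mathrm{crit}}$, then for every $u_1>0$ problem $(P)$ has a unique strictly positive solution $u$. (2) If $u_1>u_1^{\mathrm{crit}}$, then for every $u_0>0$ problem $(P)$ has a unique strictly positive solution $u$.
   Context: A solution of $(P)$ is a function $u\in C^1([0,1];\mathbb{R})$ with $u(0)=u_0$ and $u(1)=u_1$ such that the function $u\,(u'+V')$ is differentiable with zero derivative on $[0,1]$, i.e. there is a constant $c\in\mathbb{R}$ with $u(x)\,[u'(x)+V'(x)]=c$ for all $x\in[0,1]$. Strictly positive means $u(x)>0$ for all $x\in[0,1]$. *)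

theory Defs
  imports "HOL-Analysis.Analysis"
begin

text \<open>
  Functions on the unit interval are total functions of which only the values on [0,1] matter.
  Derivatives are taken within [0,1], hence one-sided at the endpoints; the library predicate
  \<open>C1_differentiable_on\<close> is not used because it asks for a two-sided derivative at 0 and 1.
\<close>

definition deriv01 :: "(real \<Rightarrow> real) \<Rightarrow> real \<Rightarrow> real" where
  "deriv01 f x = vector_derivative f (at x within {0..1})"

definition C1_01 :: "(real \<Rightarrow> real) \<Rightarrow> bool" where
  "C1_01 f \<longleftrightarrow> f differentiable_on {0..1} \<and> continuous_on {0..1} (deriv01 f)"

lemma deriv01_eqI:
  assumes "(f has_real_derivative d) (at x within {0..1})" "x \<in> {0..1}"
  shows "deriv01 f x = d"
  unfolding deriv01_def
  using assms vector_derivative_within_cbox[of 0 1 x f d]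
  by (simp add: has_real_derivative_iff_has_vector_derivative)

definition flux :: "(real \<Rightarrow> real) \<Rightarrow> (real \<Rightarrow> real) \<Rightarrow> real \<Rightarrow> real" where
  "flux V u x = u x * (deriv01 u x + deriv01 V x)"

definition is_solution :: "(real \<Rightarrow> real) \<Rightarrow> real \<Rightarrow> real \<Rightarrow> (real \<Rightarrow> real) \<Rightarrow> bool" where
  "is_solution V u0 u1 u \<longleftrightarrow>
     C1_01 u \<and> u 0 = u0 \<and> u 1 = u1 \<and>
     (\<forall>x\<in>{0..1}. (flux V u has_real_derivative 0) (at x within {0..1}))"

definition strictly_positive :: "(real \<Rightarrow> real) \<Rightarrow> bool" where
  "strictly_positive u \<longleftrightarrow> (\<forall>x\<in>{0..1}. 0 < u x)"

text \<open>Uniqueness is equality on [0,1], since values outside are irrelevant.\<close>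

definition unique_positive_solution :: "(real \<Rightarrow> real) \<Rightarrow> real \<Rightarrow> real \<Rightarrow> bool" where
  "unique_positive_solution V u0 u1 \<longleftrightarrow>
     (\<exists>u. is_solution V u0 u1 u \<and> strictly_positive u \<and>
       (\<forall>v. is_solution V u0 u1 v \<and> strictly_positive v \<longrightarrow> (\<forall>x\<in>{0..1}. v x = u x)))"

definition V_max :: "(real \<Rightarrow> real) \<Rightarrow> real" where
  "V_max V = (SUP x\<in>{0..1}. V x)"

lemma V_max_attained:
  assumes "C1_01 V"
  shows "\<exists>x\<in>{0..1}. V x = V_max V" and "\<forall>x\<in>{0..1}. V x \<le> V_max V"
proof -
  have "continuous_on {0..1} V"
    using assms by (simp add: C1_01_def differentiable_imp_continuous_on)
  then obtain m where m: "m \<in> {0..1}" "\<forall>x\<in>{0..1}. V x \<le> V m"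
    using continuous_attains_sup[of "{0..1::real}" V] by auto
  have "V_max V = V m"
    unfolding V_max_def using m by (intro cSup_eq_maximum) auto
  with m show "\<exists>x\<in>{0..1}. V x = V_max V" "\<forall>x\<in>{0..1}. V x \<le> V_max V" by auto
qed

definition u0_crit :: "(real \<Rightarrow> real) \<Rightarrow> real" where
  "u0_crit V = V_max V - V 0"

definition u1_crit :: "(real \<Rightarrow> real) \<Rightarrow> real" where
  "u1_crit V = V_max V - V 1"

end

theory Submission
  imports Defs
begin

text \<open>
  In terms of the level \<open>w = u + V\<close> the equation reads \<open>(w - V) w' = c\<close> with the constraint
  \<open>w > V\<close>. Hence \<open>w\<close> is constant if \<open>c = 0\<close> and strictly monotone otherwise.

  Uniqueness holds for all boundary values. The difference of two levels satisfies a linear first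
  order equation whose inhomogeneity has the sign of the difference of the fluxes; as it vanishes at
  both ends, the fluxes agree and so do the levels (\<open>profile_unique_flux_le\<close>).

  For existence, let the end levels be \<open>a = u0 + V 0\<close> and \<open>b = u1 + V 1\<close>. Both parts of the theorem
  assume that \<open>max a b\<close> exceeds the maximum of \<open>V\<close>. If \<open>a = b\<close>, the constant level works; if \<open>a > b\<close>,
  a reflection of the interval leads back to \<open>a < b\<close>. In that case the position is described as a
  function \<open>\<xi>\<close> of the level, which is parametrised as \<open>a + (b - a) t\<close> with \<open>t\<close> from 0 to 1. Then
  \<open>\<xi>' = p (a + (b - a) t - V(\<xi>))\<close> with a constant \<open>p\<close> inversely proportional to the flux. The
  degeneracy of the original equation at \<open>u = 0\<close> has disappeared, and the flow with \<open>\<xi>(0) = 0\<close>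
  depends continuously on \<open>p\<close> (\<open>picard_parametric\<close>). Along it the level never meets \<open>V\<close>
  (\<open>level_stays_above_lipschitz\<close>), so \<open>\<xi>\<close> increases when \<open>p > 0\<close>. Because \<open>b\<close> is above the
  maximum of \<open>V\<close>, the speed during the last part of the flow is at least a fixed multiple of \<open>p\<close>;
  so \<open>\<xi>(1)\<close> runs from 0 to beyond 1 as \<open>p\<close> grows, and some \<open>p\<close> gives \<open>\<xi>(1) = 1\<close>. The inverse
  function of this \<open>\<xi>\<close> yields the level (\<open>profile_exists_increasing\<close>).
\<close>

section \<open>Continuous dependence of flows on a parameter\<close>

text \<open>
  Turns an integral with moving upper limit into one over a fixed interval, where continuity in
  parameters is available.
\<close>
lemma integral_rescale_unit:
  fixes q :: "real \<Rightarrow> real"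
  assumes q: "continuous_on {0..1} q" and t: "t \<in> {0..1}"
  shows "integral {0..t} q = integral {0..1} (\<lambda>s. t * q (t * s))"
proof -
  define Q where "Q x = integral {0..x} q" for x
  have Q: "(Q has_real_derivative q x) (at x within {0..1})" if "x \<in> {0..1}" for x
    unfolding Q_def using integral_has_real_derivative[OF q that] .
  have img: "(\<lambda>s. t * s) ` {0..1} \<subseteq> {0..1}"
    using t by (auto intro: mult_le_one)
  have "((\<lambda>s. Q (t * s)) has_vector_derivative t * q (t * s)) (at s within {0..1})"
    if s: "s \<in> {0..1}" for s
  proof -
    have "(Q has_real_derivative q (t * s)) (at (t * s) within (\<lambda>s. t * s) ` {0..1})"
      using Q[of "t * s"] img s by (meson DERIV_subset image_subset_iff)
    from DERIV_image_chain[OF this, of t]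
    have "((\<lambda>s. Q (t * s)) has_real_derivative q (t * s) * t) (at s within {0..1})"
      by (auto intro!: derivative_eq_intros simp: o_def)
    then show ?thesis
      by (simp add: has_real_derivative_iff_has_vector_derivative mult.commute)
  qed
  then have "((\<lambda>s. t * q (t * s)) has_integral (Q (t * 1) - Q (t * 0))) {0..1}"
    by (intro fundamental_theorem_of_calculus) auto
  then have "integral {0..1} (\<lambda>s. t * q (t * s)) = Q (t * 1) - Q (t * 0)"
    by (rule integral_unique)
  also have "\<dots> = integral {0..t} q"
    by (simp add: Q_def)
  finally show ?thesis ..
qed

lemma continuous_on_integral_upper_limit_param:
  fixes G :: "'a::topological_space \<Rightarrow> real \<Rightarrow> real"
  assumes G: "continuous_on (A \<times> {0..1}) (\<lambda>(p, s). G p s)"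
  shows "continuous_on (A \<times> {0..1}) (\<lambda>(p, t). integral {0..t} (G p))"
proof -
  have "continuous_on ((A \<times> {0..1}) \<times> cbox 0 1) (\<lambda>x. snd (fst x) * (case (fst (fst x), snd (fst x) * snd x) of (p, s) \<Rightarrow> G p s))"
    by (intro continuous_on_mult continuous_on_compose2[OF G] continuous_intros)
       (auto intro: mult_le_one)
  then have "continuous_on ((A \<times> {0..1}) \<times> cbox 0 1) (\<lambda>(x, s). snd x * G (fst x) (snd x * s))"
    by (simp add: case_prod_unfold)
  then have "continuous_on (A \<times> {0..1}) (\<lambda>x. integral (cbox 0 1) (\<lambda>s. snd x * G (fst x) (snd x * s)))"
    by (rule integral_continuous_on_param)
  moreover have "integral {0..t} (G p) = integral (cbox 0 1) (\<lambda>s. t * G p (t * s))"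
    if "p \<in> A" "t \<in> {0..1}" for p t
  proof -
    have "continuous_on {0..1} (\<lambda>s. case (p, s) of (p, s) \<Rightarrow> G p s)"
      by (rule continuous_on_compose2[OF G]) (use that in \<open>auto intro!: continuous_intros\<close>)
    then show ?thesis
      using integral_rescale_unit[of "G p" t] that by simp
  qed
  ultimately show ?thesis
    by (subst continuous_on_cong[OF refl]) auto
qed

text \<open>
  The flow is obtained for all parameters at once, as one fixed point in the Banach space of
  bounded continuous functions of \<open>(p, t)\<close>, so that joint continuity needs no separate argument.
  The unknown is \<open>Y(p, t) = exp (- K t) X(p, t)\<close> rather than \<open>X\<close>: with this weight the
  Picard operator contracts on the whole time interval, with factor \<open>L / K\<close>, and no
  gluing of short-time solutions is required. Functions on the rectangle of parameters and times
  become functions on the plane by clamping the arguments to the rectangle.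
\<close>
lemma picard_parametric:
  fixes h :: "real \<Rightarrow> real \<Rightarrow> real \<Rightarrow> real"
  assumes cont: "continuous_on UNIV (\<lambda>(p, t, x). h p t x)"
    and lip: "\<And>p t x y. p \<in> {0..P} \<Longrightarrow> t \<in> {0..1} \<Longrightarrow> \<bar>h p t x - h p t y\<bar> \<le> L * \<bar>x - y\<bar>"
    and P: "0 \<le> P"
  obtains X where "continuous_on ({0..P} \<times> {0..1}) (\<lambda>(p, t). X p t)"
    and "\<And>p. p \<in> {0..P} \<Longrightarrow> X p 0 = x0"
    and "\<And>p t. p \<in> {0..P} \<Longrightarrow> t \<in> {0..1} \<Longrightarrow>
          (X p has_real_derivative h p t (X p t)) (at t within {0..1})"
proof -
  have L: "0 \<le> L"
    using lip[of 0 0 1 0] P by auto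
  \<comment> \<open>Any \<open>K \<ge> 2 L\<close> gives contraction factor \<open>1/2\<close>; the summand 1 keeps \<open>K\<close> positive when \<open>L = 0\<close>.\<close>
  define K where "K = 2 * L + 1"
  have K: "K > 0" "L / K \<le> 1 / 2"
    using L by (auto simp: K_def field_simps)
  define B where "B = cbox (0::real, 0::real) (P, 1)"
  have B: "B = {0..P} \<times> {0..1}"
    by (auto simp: B_def)
  define G where "G Y p s = h p s (exp (K * s) * apply_bcontfun Y (p, s))"
    for Y :: "(real \<times> real) \<Rightarrow>\<^sub>C real" and p s
  define F where "F Y = (\<lambda>(p, t). exp (- K * t) * (x0 + integral {0..t} (G Y p)))" for Y
  have contG: "continuous_on S (\<lambda>(p, s). G Y p s)" for Y S
  proof -
    have "continuous_on S (\<lambda>z. case (fst z, snd z, exp (K * snd z) * apply_bcontfun Y z) of (p, t, x) \<Rightarrow> h p t x)"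
      by (rule continuous_on_compose2[OF cont]) (auto intro!: continuous_intros)
    then show ?thesis
      by (simp add: G_def case_prod_unfold)
  qed
  have contG1: "continuous_on S (G Y p)" for Y p S
  proof -
    have "continuous_on S (\<lambda>s. case (p, s) of (p, s) \<Rightarrow> G Y p s)"
      by (rule continuous_on_compose2[OF contG[of UNIV]]) (auto intro!: continuous_intros)
    then show ?thesis by simp
  qed
  have contF: "continuous_on B (F Y)" for Y
  proof -
    have "continuous_on B (\<lambda>(p, t). integral {0..t} (G Y p))"
      unfolding B by (intro continuous_on_integral_upper_limit_param contG)
    then show ?thesis
      unfolding F_def case_prod_unfold by (intro continuous_intros)
  qed
  have "\<exists>Z. (\<forall>z\<in>B. apply_bcontfun Z z = F Y z) \<and> (\<forall>z. apply_bcontfun Z z = F Y (clamp (0, 0) (P, 1) z))" for Y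
    using contF[of Y] unfolding B_def by (rule continuous_on_cbox_bcontfunE) blast
  then obtain T where T: "\<And>Y z. z \<in> B \<Longrightarrow> apply_bcontfun (T Y) z = F Y z"
    "\<And>Y z. apply_bcontfun (T Y) z = F Y (clamp (0, 0) (P, 1) z)"
    by metis
  have contr: "\<bar>F Y (p, t) - F Z (p, t)\<bar> \<le> 1 / 2 * dist Y Z" if pt: "p \<in> {0..P}" "t \<in> {0..1}" for Y Z p t
  proof -
    define D where "D = dist Y Z"
    have D: "0 \<le> D" by (simp add: D_def)
    have "((\<lambda>s. L * exp (K * s) * D) has_integral (L / K * D * exp (K * t) - L / K * D * exp (K * 0))) {0..t}"
      using pt K(1) by (intro fundamental_theorem_of_calculus)
       (auto intro!: derivative_eq_intros simp flip: has_real_derivative_iff_has_vector_derivative)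
    then have I: "((\<lambda>s. L * exp (K * s) * D) has_integral (L / K * D * (exp (K * t) - 1))) {0..t}"
      by (simp add: algebra_simps)
    have "norm (integral {0..t} (\<lambda>s. G Y p s - G Z p s)) \<le> integral {0..t} (\<lambda>s. L * exp (K * s) * D)"
    proof (rule integral_norm_bound_integral)
      show "(\<lambda>s. G Y p s - G Z p s) integrable_on {0..t}"
        by (intro integrable_continuous_real continuous_intros contG1)
      show "(\<lambda>s. L * exp (K * s) * D) integrable_on {0..t}"
        using I by blast
      fix s assume s: "s \<in> {0..t}"
      have "norm (G Y p s - G Z p s) \<le> L * \<bar>exp (K * s) * apply_bcontfun Y (p, s) - exp (K * s) * apply_bcontfun Z (p, s)\<bar>"
        unfolding G_def using lip[of p s] pt s by simp
      also have "\<dots> = L * (exp (K * s) * dist (apply_bcontfun Y (p, s)) (apply_bcontfun Z (p, s)))"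
        by (simp add: dist_real_def abs_mult flip: right_diff_distrib)
      also have "\<dots> \<le> L * (exp (K * s) * D)"
        unfolding D_def using L by (intro mult_left_mono dist_bounded) auto
      finally show "norm (G Y p s - G Z p s) \<le> L * exp (K * s) * D" by (simp add: mult.assoc)
    qed
    also have "\<dots> = L / K * D * (exp (K * t) - 1)"
      using I by (rule integral_unique)
    also have "\<dots> \<le> 1 / 2 * D * exp (K * t)"
      using K D pt by (intro mult_mono) auto
    finally have *: "\<bar>integral {0..t} (G Y p) - integral {0..t} (G Z p)\<bar> \<le> 1 / 2 * D * exp (K * t)"
      by (subst (asm) integral_diff) (auto intro!: integrable_continuous_real contG1)
    have "\<bar>F Y (p, t) - F Z (p, t)\<bar> = exp (- K * t) * \<bar>integral {0..t} (G Y p) - integral {0..t} (G Z p)\<bar>"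
      by (simp add: F_def abs_mult flip: right_diff_distrib)
    also have "\<dots> \<le> exp (- K * t) * (1 / 2 * D * exp (K * t))"
      using * by (intro mult_left_mono) auto
    also have "\<dots> = 1 / 2 * D" by (simp add: exp_minus)
    finally show ?thesis by (simp add: D_def)
  qed
  have "dist (T Y) (T Z) \<le> 1 / 2 * dist Y Z" for Y Z
  proof (rule dist_bound)
    fix z
    have "clamp (0, 0) (P, 1) z \<in> B"
      unfolding B_def using P by (intro clamp_in_interval) (auto simp: Basis_prod_def)
    then show "dist (apply_bcontfun (T Y) z) (apply_bcontfun (T Z) z) \<le> 1 / 2 * dist Y Z"
      unfolding T(2) dist_real_def using contr B by (metis (no_types, lifting) SigmaE)
  qed
  then obtain Y where Y: "T Y = Y"
    using banach_fix_type[of "1/2" T] by auto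
  define X where "X p t = exp (K * t) * apply_bcontfun Y (p, t)" for p t
  have X: "X p t = x0 + integral {0..t} (\<lambda>s. h p s (X p s))" if pt: "p \<in> {0..P}" "t \<in> {0..1}" for p t
  proof -
    have "apply_bcontfun Y (p, t) = F Y (p, t)"
      using T(1)[of "(p, t)" Y] pt unfolding Y B by simp
    then show ?thesis
      by (simp add: X_def F_def G_def[abs_def] exp_minus)
  qed
  show thesis
  proof
    show "continuous_on ({0..P} \<times> {0..1}) (\<lambda>(p, t). X p t)"
      unfolding X_def case_prod_unfold by (auto intro!: continuous_intros)
    show "X p 0 = x0" if "p \<in> {0..P}" for p
      using X[of p 0] that by simp
    show "(X p has_real_derivative h p t (X p t)) (at t within {0..1})"
      if pt: "p \<in> {0..P}" "t \<in> {0..1}" for p t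
    proof -
      have "((\<lambda>t. integral {0..t} (G Y p)) has_real_derivative G Y p t) (at t within {0..1})"
        by (intro integral_has_real_derivative contG1 pt)
      then have "((\<lambda>t. x0 + integral {0..t} (\<lambda>s. h p s (X p s))) has_real_derivative h p t (X p t)) (at t within {0..1})"
        by (auto intro!: derivative_eq_intros simp: G_def[abs_def] X_def)
      then show ?thesis
        by (rule has_field_derivative_transform_within[where d=1]) (use pt X in auto)
    qed
  qed
qed

section \<open>Calculus on the closed unit interval\<close>

lemma mvt_unit:
  fixes f f' :: "real \<Rightarrow> real"
  assumes f: "\<And>x. x \<in> {0..1} \<Longrightarrow> (f has_real_derivative f' x) (at x within {0..1})"
    and ab: "0 \<le> a" "a < b" "b \<le> 1"
  obtains z where "z \<in> {a<..<b}" "f b - f a = f' z * (b - a)"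
proof -
  have "(f has_derivative (\<lambda>h. f' x * h)) (at x within {a..b})" if "a \<le> x" "x \<le> b" for x
    using DERIV_subset[OF f, of x "{a..b}"] ab that by (auto simp: has_field_derivative_def)
  with mvt_simple[of a b f "\<lambda>x h. f' x * h"] ab that show thesis
    by auto
qed

text \<open>
  The inverse function theorem on a closed interval, with the one-sided derivatives at both ends.
\<close>
lemma increasing_inverse_unit:
  fixes \<xi> D :: "real \<Rightarrow> real"
  assumes \<xi>: "\<And>t. t \<in> {0..1} \<Longrightarrow> (\<xi> has_real_derivative D t) (at t within {0..1})"
    and D: "\<And>t. t \<in> {0..1} \<Longrightarrow> 0 < D t" and ends: "\<xi> 0 = 0" "\<xi> 1 = 1"
  obtains \<tau> where "\<tau> 0 = 0" "\<tau> 1 = 1"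
    and "\<And>x. x \<in> {0..1} \<Longrightarrow> \<tau> x \<in> {0..1}"
    and "\<And>x. x \<in> {0..1} \<Longrightarrow> \<xi> (\<tau> x) = x"
    and "\<And>x. x \<in> {0..1} \<Longrightarrow> (\<tau> has_real_derivative 1 / D (\<tau> x)) (at x within {0..1})"
proof -
  have cont: "continuous_on {0..1} \<xi>"
    using \<xi> by (meson DERIV_continuous continuous_on_eq_continuous_within)
  have less: "\<xi> s < \<xi> t" if st: "0 \<le> s" "s < t" "t \<le> 1" for s t
  proof -
    obtain z where "z \<in> {s<..<t}" "\<xi> t - \<xi> s = D z * (t - s)"
      using mvt_unit[of \<xi> D s t] \<xi> st by blast
    moreover from this have "0 < D z" using st by (intro D) auto
    ultimately show ?thesis
      using st by (metis diff_gt_0_iff_gt mult_pos_pos)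
  qed
  have inj: "inj_on \<xi> {0..1}"
    by (rule linorder_inj_onI) (use less in fastforce)+
  have img: "\<xi> ` {0..1} = {0..1}"
  proof
    show "\<xi> ` {0..1} \<subseteq> {0..1}"
    proof
      fix y assume "y \<in> \<xi> ` {0..1}"
      then obtain t where "t \<in> {0..1}" "y = \<xi> t" by auto
      then show "y \<in> {0..1}"
        using less[of 0 t] less[of t 1] ends by (cases "t = 0"; cases "t = 1") auto
    qed
    show "{0..1} \<subseteq> \<xi> ` {0..1}"
      using IVT'[of \<xi> 0 _ 1] cont ends by (fastforce simp: image_iff)
  qed
  define \<tau> where "\<tau> = inv_into {0..1} \<xi>"
  have \<tau>\<xi>: "\<tau> (\<xi> t) = t" if "t \<in> {0..1}" for t
    unfolding \<tau>_def using inj that by simp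
  have \<tau>: "\<tau> x \<in> {0..1}" "\<xi> (\<tau> x) = x" if "x \<in> {0..1}" for x
    using that img inv_into_into[of x \<xi> "{0..1}"] f_inv_into_f[of x \<xi> "{0..1}"]
    by (simp_all add: \<tau>_def del: atLeastAtMost_iff)
  have cont\<tau>: "continuous_on {0..1} \<tau>"
    using continuous_on_inv[OF cont compact_Icc] \<tau>\<xi> img by auto
  show thesis
  proof
    show "\<tau> 0 = 0" "\<tau> 1 = 1"
      using \<tau>\<xi>[of 0] \<tau>\<xi>[of 1] ends by auto
    fix x :: real assume x: "x \<in> {0..1}"
    show "\<tau> x \<in> {0..1}" "\<xi> (\<tau> x) = x" using \<tau>[OF x] .
    have "D (\<tau> x) \<noteq> 0" using D[OF \<tau>(1)[OF x]] by simp
    have "(\<tau> has_derivative (\<lambda>h. 1 / D (\<tau> x) * h)) (at (\<xi> (\<tau> x)) within \<xi> ` {0..1})"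
    proof (rule has_derivative_inverse_within[where f' = "\<lambda>h. D (\<tau> x) * h"])
      show "(\<xi> has_derivative (\<lambda>h. D (\<tau> x) * h)) (at (\<tau> x) within {0..1})"
        using \<xi>[OF \<tau>(1)[OF x]] by (simp add: has_field_derivative_def)
      show "continuous (at (\<xi> (\<tau> x)) within \<xi> ` {0..1}) \<tau>"
        using cont\<tau> x by (simp add: img \<tau> continuous_on_eq_continuous_within)
      show "linear (\<lambda>h. 1 / D (\<tau> x) * h)"
        by (rule bounded_linear.linear[OF bounded_linear_mult_right])
      show "(\<lambda>h. 1 / D (\<tau> x) * h) \<circ> (\<lambda>h. D (\<tau> x) * h) = id"
        using \<open>D (\<tau> x) \<noteq> 0\<close> by auto
    qed (use \<tau>(1)[OF x] \<tau>\<xi> in auto)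
    then show "(\<tau> has_real_derivative 1 / D (\<tau> x)) (at x within {0..1})"
      by (simp only: has_field_derivative_def img \<tau>(2)[OF x])
  qed
qed

lemma C1_01_has_derivative:
  assumes "C1_01 f" "x \<in> {0..1}"
  shows "(f has_real_derivative deriv01 f x) (at x within {0..1})"
proof -
  obtain d where "(f has_real_derivative d) (at x within {0..1})"
    using assms unfolding C1_01_def differentiable_on_def
    by (metis real_differentiableE)
  then show ?thesis
    using assms deriv01_eqI by metis
qed

lemma C1_01I:
  assumes f: "\<And>x. x \<in> {0..1} \<Longrightarrow> (f has_real_derivative f' x) (at x within {0..1})"
    and f': "continuous_on {0..1} f'"
  shows "C1_01 f"
  unfolding C1_01_def
proof
  show "f differentiable_on {0..1}"
    unfolding differentiable_on_def using f real_differentiable_def by blast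
  show "continuous_on {0..1} (deriv01 f)"
    using f' deriv01_eqI[OF f] by (subst continuous_on_cong[OF refl]) auto
qed

lemma C1_01_continuous: "C1_01 f \<Longrightarrow> continuous_on {0..1} f"
  by (simp add: C1_01_def differentiable_imp_continuous_on)

lemma has_real_derivative_reflect_unit:
  fixes f :: "real \<Rightarrow> real"
  assumes "(f has_real_derivative d) (at (1 - x) within {0..1})"
  shows "((\<lambda>x. f (1 - x)) has_real_derivative - d) (at x within {0..1})"
proof -
  have "(f has_real_derivative d) (at (1 - x) within (\<lambda>x. 1 - x) ` {0..1})"
    using assms by simp
  moreover have "((\<lambda>x. 1 - x) has_real_derivative - 1) (at x within {0..1})"
    by (auto intro!: derivative_eq_intros)
  ultimately have "(f \<circ> (\<lambda>x. 1 - x) has_real_derivative d * - 1) (at x within {0..1})"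
    by (rule DERIV_image_chain)
  then show ?thesis by (simp add: o_def)
qed

lemma C1_01_reflect:
  assumes "C1_01 f"
  shows "C1_01 (\<lambda>x. f (1 - x))"
proof (rule C1_01I)
  fix x :: real assume x: "x \<in> {0..1}"
  then show "((\<lambda>x. f (1 - x)) has_real_derivative - deriv01 f (1 - x)) (at x within {0..1})"
    by (intro has_real_derivative_reflect_unit C1_01_has_derivative assms) auto
next
  show "continuous_on {0..1} (\<lambda>x. - deriv01 f (1 - x))"
    using assms unfolding C1_01_def
    by (auto intro!: continuous_intros continuous_on_compose2[of "{0..1}" "deriv01 f"])
qed

lemma V_max_reflect: "V_max (\<lambda>x. V (1 - x)) = V_max V"
proof -
  have "(\<lambda>x. V (1 - x)) ` {0..1} = V ` {0..1}"
  proof -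
    have "(\<lambda>x. 1 - x) ` {0..1} = {0..1::real}" by simp
    then show ?thesis by (metis image_image)
  qed
  then show ?thesis by (simp add: V_max_def)
qed

section \<open>Positive solutions and their levels\<close>

text \<open>
  A profile is the total level \<open>w = u + V\<close> of a strictly positive solution \<open>u\<close> whose flux is the
  constant \<open>c\<close>. Since \<open>(w - V) w' = c\<close>, it has a monotonicity that \<open>u\<close> itself lacks.
\<close>
definition profile :: "(real \<Rightarrow> real) \<Rightarrow> real \<Rightarrow> (real \<Rightarrow> real) \<Rightarrow> bool" where
  "profile V c w \<longleftrightarrow> (\<forall>x\<in>{0..1}. V x < w x \<and>
     (w has_real_derivative c / (w x - V x)) (at x within {0..1}))"

lemma profile_continuous: "profile V c w \<Longrightarrow> continuous_on {0..1} w"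
  unfolding profile_def by (meson DERIV_continuous continuous_on_eq_continuous_within)

lemma profile_imp_solution:
  assumes V: "C1_01 V" and w: "profile V c w"
  shows "is_solution V (w 0 - V 0) (w 1 - V 1) (\<lambda>x. w x - V x)"
    and "strictly_positive (\<lambda>x. w x - V x)"
proof -
  have pos: "w x - V x > 0" if "x \<in> {0..1}" for x
    using w that by (auto simp: profile_def)
  then show "strictly_positive (\<lambda>x. w x - V x)"
    by (simp add: strictly_positive_def)
  have u: "((\<lambda>x. w x - V x) has_real_derivative c / (w x - V x) - deriv01 V x) (at x within {0..1})"
    if "x \<in> {0..1}" for x
    using w that unfolding profile_def
    by (intro DERIV_diff C1_01_has_derivative[OF V]) auto
  have "continuous_on {0..1} (\<lambda>x. c / (w x - V x) - deriv01 V x)"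
    using pos V profile_continuous[OF w] C1_01_continuous[OF V]
    by (intro continuous_intros) (auto simp: C1_01_def less_imp_neq[symmetric])
  then have "C1_01 (\<lambda>x. w x - V x)"
    using u by (rule C1_01I[rotated])
  moreover have flux: "flux V (\<lambda>x. w x - V x) x = c" if "x \<in> {0..1}" for x
    using pos[OF that] deriv01_eqI[OF u[OF that] that] by (simp add: flux_def)
  have "(flux V (\<lambda>x. w x - V x) has_real_derivative 0) (at x within {0..1})"
    if "x \<in> {0..1}" for x
    by (rule has_field_derivative_transform_within[OF DERIV_const[of c] zero_less_one that])
       (simp add: flux)
  ultimately show "is_solution V (w 0 - V 0) (w 1 - V 1) (\<lambda>x. w x - V x)"
    by (simp add: is_solution_def)
qed

lemma solution_imp_profile:
  assumes V: "C1_01 V" and u: "is_solution V u0 u1 u" "strictly_positive u"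
  obtains c where "profile V c (\<lambda>x. u x + V x)"
proof -
  have "convex {0..1::real}" by simp
  then obtain c where c: "\<And>x. x \<in> {0..1} \<Longrightarrow> flux V u x = c"
    using has_field_derivative_zero_constant[of "{0..1}" "flux V u"] u(1)
    by (metis is_solution_def)
  have "profile V c (\<lambda>x. u x + V x)"
    unfolding profile_def
  proof (intro ballI conjI)
    fix x :: real assume x: "x \<in> {0..1}"
    have pos: "u x > 0" using u(2) x by (simp add: strictly_positive_def)
    then show "V x < u x + V x" by simp
    have "deriv01 u x + deriv01 V x = c / (u x + V x - V x)"
      using c[OF x] pos by (simp add: flux_def field_simps)
    moreover have "((\<lambda>x. u x + V x) has_real_derivative deriv01 u x + deriv01 V x) (at x within {0..1})"
      using u(1) x V by (intro DERIV_add C1_01_has_derivative) (auto simp: is_solution_def)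
    ultimately show "((\<lambda>x. u x + V x) has_real_derivative c / (u x + V x - V x)) (at x within {0..1})"
      by simp
  qed
  then show thesis ..
qed

lemma profile_reflect:
  assumes w: "profile (\<lambda>x. V (1 - x)) c w"
  shows "profile V (- c) (\<lambda>x. w (1 - x))"
  unfolding profile_def
proof (intro ballI conjI)
  fix x :: real assume x: "x \<in> {0..1}"
  then have x': "1 - x \<in> {0..1}" by simp
  then show "V x < w (1 - x)"
    using w unfolding profile_def by fastforce
  have "(w has_real_derivative c / (w (1 - x) - V x)) (at (1 - x) within {0..1})"
    using w x' unfolding profile_def by fastforce
  then show "((\<lambda>x. w (1 - x)) has_real_derivative - c / (w (1 - x) - V x)) (at x within {0..1})"
    using has_real_derivative_reflect_unit by fastforce
qed

section \<open>Uniqueness\<close>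

text \<open>
  The difference \<open>h = w - z\<close> satisfies the linear equation
  \<open>h' + q h = (c - d) / (w - V)\<close> with \<open>q = d / ((w - V) (z - V))\<close>. With the integrating factor,
  \<open>H = exp (\<integral>q) h\<close> has a derivative of constant sign, while it vanishes at both ends; this forces
  \<open>c = d\<close>, and then \<open>H\<close> is constant.
\<close>
lemma profile_unique_flux_le:
  assumes V: "continuous_on {0..1} V"
    and w: "profile V c w" and z: "profile V d z" and dc: "d \<le> c"
    and bc: "w 0 = z 0" "w 1 = z 1" and x: "x \<in> {0..1}"
  shows "w x = z x"
proof -
  have pos: "w x - V x > 0" "z x - V x > 0" if "x \<in> {0..1}" for x
    using w z that by (auto simp: profile_def)
  define q where "q x = d / ((w x - V x) * (z x - V x))" for x
  have "continuous_on {0..1} q"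
    unfolding q_def using pos
    by (intro continuous_intros V profile_continuous[OF w] profile_continuous[OF z])
       (auto simp: less_imp_neq[symmetric])
  then have Q: "((\<lambda>x. integral {0..x} q) has_real_derivative q x) (at x within {0..1})"
    if "x \<in> {0..1}" for x
    using integral_has_real_derivative that by blast
  define H where "H x = exp (integral {0..x} q) * (w x - z x)" for x
  have H: "(H has_real_derivative exp (integral {0..x} q) * ((c - d) / (w x - V x))) (at x within {0..1})"
    if x: "x \<in> {0..1}" for x
  proof -
    have "c / (w x - V x) - d / (z x - V x) + q x * (w x - z x) = (c - d) / (w x - V x)"
      unfolding q_def using pos[OF x] by (simp add: divide_simps) (simp add: algebra_simps)
    moreover have "(H has_real_derivative exp (integral {0..x} q) * (c / (w x - V x) - d / (z x - V x) + q x * (w x - z x)))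
        (at x within {0..1})"
      using w z x unfolding H_def[abs_def] profile_def
      by (auto intro!: derivative_eq_intros Q simp: algebra_simps)
    ultimately show ?thesis by simp
  qed
  have H01: "H 0 = 0" "H 1 = 0"
    using bc by (auto simp: H_def)
  have "\<not> d < c"
  proof
    assume "d < c"
    obtain y where "y \<in> {0<..<1}" "H 1 - H 0 = exp (integral {0..y} q) * ((c - d) / (w y - V y)) * (1 - 0)"
      using mvt_unit[of H "\<lambda>x. exp (integral {0..x} q) * ((c - d) / (w x - V x))" 0 1] H by auto
    with H01 pos(1)[of y] \<open>d < c\<close> show False by auto
  qed
  with dc have "c = d" by simp
  have "H x = 0"
  proof (cases "x = 0")
    case False
    then obtain y where "H x - H 0 = exp (integral {0..y} q) * ((c - d) / (w y - V y)) * (x - 0)"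
      using mvt_unit[of H "\<lambda>x. exp (integral {0..x} q) * ((c - d) / (w x - V x))" 0 x] H x by auto
    with H01 \<open>c = d\<close> show ?thesis by simp
  qed (simp add: H01)
  then show ?thesis by (simp add: H_def)
qed

lemma profile_unique:
  assumes "continuous_on {0..1} V" "profile V c w" "profile V d z"
    "w 0 = z 0" "w 1 = z 1" "x \<in> {0..1}"
  shows "w x = z x"
  using profile_unique_flux_le[of V c w d z x] profile_unique_flux_le[of V d z c w x] assms
  by (cases "d \<le> c") auto

section \<open>Existence by exchanging level and position\<close>

text \<open>
  Here \<open>\<xi>(t)\<close> is the position at which the rising level \<open>\<alpha> + \<kappa> t\<close> is attained. It moves with a
  speed proportional to the gap between level and obstacle, so it is slow when the gap is small;
  then the obstacle seen from \<open>\<xi>\<close> varies more slowly than the level rises, and the gap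
  cannot close.
\<close>
lemma level_stays_above_lipschitz:
  fixes W \<xi> :: "real \<Rightarrow> real"
  assumes W: "\<And>x y. \<bar>W x - W y\<bar> \<le> L * \<bar>x - y\<bar>"
    and \<xi>: "\<And>t. t \<in> {0..1} \<Longrightarrow>
          (\<xi> has_real_derivative p * (\<alpha> + \<kappa> * t - W (\<xi> t))) (at t within {0..1})"
    and p: "0 \<le> p" and \<kappa>: "0 < \<kappa>" and start: "W (\<xi> 0) < \<alpha>" and t: "t \<in> {0..1}"
  shows "W (\<xi> t) < \<alpha> + \<kappa> * t"
proof (rule ccontr)
  have L: "0 \<le> L" using W[of 1 0] by auto
  define g where "g t = \<alpha> + \<kappa> * t - W (\<xi> t)" for t
  have contW: "continuous_on UNIV W"
    using W L by (intro lipschitz_on_continuous_on[of L] lipschitz_onI) (auto simp: dist_real_def)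
  have cont\<xi>: "continuous_on {0..1} \<xi>"
    using \<xi> by (meson DERIV_continuous continuous_on_eq_continuous_within)
  have contg: "continuous_on {0..1} g"
    unfolding g_def by (intro continuous_intros continuous_on_compose2[OF contW cont\<xi>]) auto
  assume "\<not> ?thesis"
  then have "{t \<in> {0..1}. g t \<le> 0} \<noteq> {}"
    using t by (auto simp: g_def)
  moreover have "compact {t \<in> {0..1}. g t \<le> 0}"
    using continuous_closed_preimage[OF contg closed_real_atLeastAtMost, of "{..0}"]
    by (auto simp: compact_eq_bounded_closed vimage_def Int_def
             intro: bounded_subset[OF bounded_closed_interval[of 0 1]])
  ultimately obtain t1 where t1: "t1 \<in> {0..1}" "g t1 \<le> 0"
    and min: "\<And>s. s \<in> {0..1} \<Longrightarrow> g s \<le> 0 \<Longrightarrow> t1 \<le> s"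
    using compact_attains_inf by (metis (mono_tags, lifting) mem_Collect_eq)
  have "t1 \<noteq> 0"
    using start t1 by (auto simp: g_def)
  \<comment> \<open>While the gap is below \<open>\<epsilon>\<close>, the obstacle at \<open>\<xi>\<close> changes at a rate at most \<open>L p \<epsilon> < \<kappa>\<close>.\<close>
  define \<epsilon> where "\<epsilon> = \<kappa> / (2 * (L * p + 1))"
  have Lp: "L * p \<ge> 0" using L p by simp
  have \<epsilon>: "\<epsilon> > 0"
    using Lp \<kappa> by (simp add: \<epsilon>_def)
  have "\<kappa> = 2 * (L * p + 1) * \<epsilon>"
    using Lp by (simp add: \<epsilon>_def)
  also have "\<dots> = L * p * \<epsilon> + (L * p * \<epsilon> + 2 * \<epsilon>)"
    by (simp add: algebra_simps)
  finally have L\<epsilon>: "L * p * \<epsilon> < \<kappa>"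
    using mult_nonneg_nonneg[of "L * p" \<epsilon>] Lp \<epsilon> by linarith
  obtain d where d: "d > 0" "\<And>s. s \<in> {0..1} \<Longrightarrow> \<bar>s - t1\<bar> < d \<Longrightarrow> \<bar>g s - g t1\<bar> < \<epsilon>"
    using contg t1 \<epsilon> unfolding continuous_on_iff dist_real_def by blast
  define t0 where "t0 = max 0 (t1 - d / 2)"
  have t0: "0 \<le> t0" "t0 < t1" "t1 \<le> 1" "t1 - t0 < d"
    using \<open>t1 \<noteq> 0\<close> t1 d by (auto simp: t0_def)
  obtain z where z: "z \<in> {t0<..<t1}" "\<xi> t1 - \<xi> t0 = p * g z * (t1 - t0)"
    using mvt_unit[of \<xi> "\<lambda>t. p * g t" t0 t1] \<xi> t0 unfolding g_def by blast
  have "g z > 0"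
    using min[of z] z t0 by fastforce
  moreover have "g z < \<epsilon>"
    using d(2)[of z] z t0 t1 by auto
  ultimately have "\<bar>\<xi> t1 - \<xi> t0\<bar> \<le> p * \<epsilon> * (t1 - t0)"
    unfolding z using p t0 by (simp add: abs_mult mult_left_mono mult_right_mono)
  then have "L * \<bar>\<xi> t1 - \<xi> t0\<bar> \<le> L * p * \<epsilon> * (t1 - t0)"
    using mult_left_mono[OF _ L] by (fastforce simp: mult.assoc)
  also have "\<dots> < \<kappa> * (t1 - t0)"
    using L\<epsilon> t0 by simp
  finally have "W (\<xi> t1) - W (\<xi> t0) < \<kappa> * (t1 - t0)"
    using W[of "\<xi> t1" "\<xi> t0"] by linarith
  then have "g t0 < g t1"
    by (simp add: g_def algebra_simps)
  with t1 min[of t0] t0 show False by auto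
qed

text \<open>
  Exchanging the roles of level and position removes the singularity at \<open>w = V\<close>: the position
  \<open>\<xi>\<close> at which the level is \<open>\<alpha> + \<kappa> t\<close> solves \<open>\<xi>' = p (\<alpha> + \<kappa> t - V(\<xi>))\<close> with \<open>p = \<kappa> / c\<close>, whose
  right-hand side is Lipschitz in \<open>\<xi>\<close>. The flow starts at 0 and one shoots for \<open>\<xi>(1) = 1\<close>:
  for \<open>p = 0\<close> the position does not move, and for large \<open>p\<close> it passes 1, because
  the final level \<open>\<beta>\<close> lies above the maximum of \<open>V\<close>. The initial level only has to lie above \<open>V 0\<close>,
  as the gap stays open along the flow.
\<close>
lemma profile_exists_increasing:
  assumes V: "C1_01 V" and "V 0 < \<alpha>" "\<alpha> < \<beta>" "V_max V < \<beta>"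
  obtains c w where "profile V c w" "w 0 = \<alpha>" "w 1 = \<beta>"
proof -
  define \<kappa> where "\<kappa> = \<beta> - \<alpha>"
  have \<kappa>: "\<kappa> > 0" using assms by (simp add: \<kappa>_def)
  \<comment> \<open>Extending \<open>V\<close> by its end values keeps it Lipschitz and bounded by the same maximum.\<close>
  define W where "W x = V (clamp 0 1 x)" for x
  have clamp: "clamp 0 1 x \<in> {0..1}" for x :: real
    using clamp_in_interval[of 0 1 x] by simp
  have W: "W x = V x" if "x \<in> {0..1}" for x
    using that by (simp add: W_def)
  have W_le: "W x \<le> V_max V" for x
    using V_max_attained(2)[OF V] clamp by (simp add: W_def)
  have "bounded (deriv01 V ` {0..1})"
    using V by (intro compact_imp_bounded compact_continuous_image) (auto simp: C1_01_def)
  then obtain L where L: "\<And>x. x \<in> {0..1} \<Longrightarrow> norm (deriv01 V x) \<le> L"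
    by (metis bounded_iff image_eqI)
  then have "L \<ge> 0"
    by (metis atLeastAtMost_iff norm_ge_zero order.trans order_refl zero_le_one)
  have W_lip: "\<bar>W x - W y\<bar> \<le> L * \<bar>x - y\<bar>" for x y
  proof -
    have "norm (W x - W y) \<le> L * norm (clamp 0 1 x - clamp 0 1 y)"
      unfolding W_def
      by (rule field_differentiable_bound[OF _ C1_01_has_derivative[OF V] L])
         (use clamp in \<open>auto simp del: atLeastAtMost_iff\<close>)
    also have "\<dots> \<le> L * norm (x - y)"
      using dist_clamps_le_dist_args[of 0 1 x y] \<open>L \<ge> 0\<close>
      by (intro mult_left_mono) (auto simp: dist_norm)
    finally show ?thesis by simp
  qed
  then have contW: "continuous_on UNIV W"
    using \<open>L \<ge> 0\<close> by (intro lipschitz_on_continuous_on[of L] lipschitz_onI) (auto simp: dist_real_def)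
  \<comment> \<open>From time \<open>t0\<close> on, the level is at least \<open>m\<close> and exceeds \<open>V\<close> by at least \<open>\<delta>\<close>. At speed factor
      \<open>P\<close> the remaining time \<open>1 - t0\<close> therefore suffices to travel a distance of 1.\<close>
  define m where "m = max \<alpha> ((V_max V + \<beta>) / 2)"
  define \<delta> where "\<delta> = m - V_max V"
  define t0 where "t0 = (m - \<alpha>) / \<kappa>"
  have \<delta>: "\<delta> > 0" and m: "\<alpha> \<le> m" "m < \<beta>"
    using assms by (auto simp: \<delta>_def m_def less_max_iff_disj)
  have t0: "0 \<le> t0" "t0 < 1" "\<alpha> + \<kappa> * t0 = m"
    using m \<kappa> by (auto simp: t0_def \<kappa>_def)
  define P where "P = 1 / (\<delta> * (1 - t0))"
  have P: "P > 0" "P * \<delta> * (1 - t0) = 1"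
    using \<delta> t0 by (auto simp: P_def)
  have cont_speed: "continuous_on UNIV (\<lambda>(p, t, x). p * (\<alpha> + \<kappa> * t - W x))"
    unfolding case_prod_unfold
    by (intro continuous_intros continuous_on_compose2[OF contW]) auto
  have lip_speed: "\<bar>p * (\<alpha> + \<kappa> * t - W x) - p * (\<alpha> + \<kappa> * t - W y)\<bar> \<le> (P * L) * \<bar>x - y\<bar>"
    if "p \<in> {0..P}" for p t x y
  proof -
    have "\<bar>p * (\<alpha> + \<kappa> * t - W x) - p * (\<alpha> + \<kappa> * t - W y)\<bar> = p * \<bar>W x - W y\<bar>"
      using that by (simp add: abs_mult abs_minus_commute flip: right_diff_distrib)
    also have "\<dots> \<le> P * (L * \<bar>x - y\<bar>)"
      using that P W_lip by (intro mult_mono) auto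
    finally show ?thesis by (simp add: mult.assoc)
  qed
  obtain X where contX: "continuous_on ({0..P} \<times> {0..1}) (\<lambda>(p, t). X p t)"
    and X0: "\<And>p. p \<in> {0..P} \<Longrightarrow> X p 0 = 0"
    and X: "\<And>p t. p \<in> {0..P} \<Longrightarrow> t \<in> {0..1} \<Longrightarrow>
        (X p has_real_derivative p * (\<alpha> + \<kappa> * t - W (X p t))) (at t within {0..1})"
    using picard_parametric[OF cont_speed lip_speed less_imp_le[OF P(1)], of 0] by blast
  have above: "W (X p t) < \<alpha> + \<kappa> * t" if "p \<in> {0..P}" "t \<in> {0..1}" for p t
    by (rule level_stays_above_lipschitz[where \<xi> = "X p" and p = p, OF W_lip])
       (use that X X0 \<kappa> W[of 0] assms in auto)
  have incr: "\<exists>z\<in>{s<..<t}. X p t - X p s = p * (\<alpha> + \<kappa> * z - W (X p z)) * (t - s)"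
    if "p \<in> {0..P}" "0 \<le> s" "s < t" "t \<le> 1" for p s t
    using mvt_unit[of "X p" "\<lambda>t. p * (\<alpha> + \<kappa> * t - W (X p t))" s t] X that by blast
  have "0 \<le> X P t0"
  proof (cases "t0 = 0")
    case False
    then obtain z where "z \<in> {0<..<t0}" "X P t0 - X P 0 = P * (\<alpha> + \<kappa> * z - W (X P z)) * (t0 - 0)"
      using incr[of P 0 t0] P t0 by auto
    then show ?thesis
      using above[of P z] P t0 X0[of P] by auto
  qed (use X0[of P] P in auto)
  moreover have "1 \<le> X P 1 - X P t0"
  proof -
    obtain z where z: "z \<in> {t0<..<1}" "X P 1 - X P t0 = P * (\<alpha> + \<kappa> * z - W (X P z)) * (1 - t0)"
      using incr[of P t0 1] P t0 by auto
    have "\<kappa> * t0 \<le> \<kappa> * z" using \<kappa> z by simp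
    then have "\<delta> \<le> \<alpha> + \<kappa> * z - W (X P z)"
      using W_le[of "X P z"] t0 unfolding \<delta>_def by linarith
    then have "P * \<delta> * (1 - t0) \<le> P * (\<alpha> + \<kappa> * z - W (X P z)) * (1 - t0)"
      using P t0 by (intro mult_right_mono mult_left_mono) auto
    with z P show ?thesis by simp
  qed
  ultimately have "1 \<le> X P 1" by simp
  have "X 0 1 = 0"
    using incr[of 0 0 1] X0[of 0] P by auto
  have "continuous_on {0..P} (\<lambda>p. case (p, 1) of (p, t) \<Rightarrow> X p t)"
    by (rule continuous_on_compose2[OF contX]) (auto intro!: continuous_intros)
  then obtain p where p: "0 \<le> p" "p \<le> P" "X p 1 = 1"
    using IVT'[of "\<lambda>p. X p 1" 0 1 P] \<open>X 0 1 = 0\<close> \<open>1 \<le> X P 1\<close> P by auto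
  with \<open>X 0 1 = 0\<close> have "p > 0" by (cases "p = 0") auto
  define D where "D t = p * (\<alpha> + \<kappa> * t - W (X p t))" for t
  have D: "(X p has_real_derivative D t) (at t within {0..1})" "0 < D t" if "t \<in> {0..1}" for t
    using X[of p t] above[of p t] that p \<open>p > 0\<close> by (auto simp: D_def)
  have "X p 0 = 0"
    using X0 p by auto
  obtain \<tau> where \<tau>01: "\<tau> 0 = 0" "\<tau> 1 = 1"
    and \<tau>: "\<And>x. x \<in> {0..1} \<Longrightarrow> \<tau> x \<in> {0..1}"
     "\<And>x. x \<in> {0..1} \<Longrightarrow> X p (\<tau> x) = x"
     "\<And>x. x \<in> {0..1} \<Longrightarrow> (\<tau> has_real_derivative 1 / D (\<tau> x)) (at x within {0..1})"
    using increasing_inverse_unit[OF D \<open>X p 0 = 0\<close> p(3)] by blast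
  show thesis
  proof
    show "\<alpha> + \<kappa> * \<tau> 0 = \<alpha>" "\<alpha> + \<kappa> * \<tau> 1 = \<beta>"
      by (simp_all add: \<tau>01 \<kappa>_def)
    show "profile V (\<kappa> / p) (\<lambda>x. \<alpha> + \<kappa> * \<tau> x)"
      unfolding profile_def
    proof (intro ballI conjI)
      fix x :: real assume x: "x \<in> {0..1}"
      show "V x < \<alpha> + \<kappa> * \<tau> x"
        using above[of p "\<tau> x"] \<tau>[OF x] p W[OF x] by simp
      have "((\<lambda>x. \<alpha> + \<kappa> * \<tau> x) has_real_derivative \<kappa> * (1 / D (\<tau> x))) (at x within {0..1})"
        by (auto intro!: derivative_eq_intros \<tau>(3)[OF x])
      moreover have "\<kappa> * (1 / D (\<tau> x)) = \<kappa> / p / (\<alpha> + \<kappa> * \<tau> x - V x)"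
        using \<tau>(2)[OF x] W[OF x] by (simp add: D_def)
      ultimately show "((\<lambda>x. \<alpha> + \<kappa> * \<tau> x) has_real_derivative \<kappa> / p / (\<alpha> + \<kappa> * \<tau> x - V x)) (at x within {0..1})"
        by metis
    qed
  qed
qed

text \<open>
  The sign of the flux is that of \<open>b - a\<close>. The reflection \<open>x \<mapsto> 1 - x\<close> reverses it, so that the
  larger of two different end levels, which is the supercritical one, may be assumed to be at the
  right end.
\<close>
lemma profile_exists:
  assumes V: "C1_01 V" and "V 0 < a" "V 1 < b" "V_max V < max a b"
  obtains c w where "profile V c w" "w 0 = a" "w 1 = b"
proof (cases a b rule: linorder_cases)
  case less
  then show thesis
    using profile_exists_increasing[of V a b] assms that by auto
next
  case equal
  have "V x < a" if "x \<in> {0..1}" for x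
    using V_max_attained(2)[OF V] that assms equal by fastforce
  then have "profile V 0 (\<lambda>x. a)"
    by (simp add: profile_def)
  with that equal show thesis by blast
next
  case greater
  obtain c w where "profile (\<lambda>x. V (1 - x)) c w" "w 0 = b" "w 1 = a"
    using profile_exists_increasing[of "\<lambda>x. V (1 - x)" b a] C1_01_reflect[OF V] assms greater
    by (auto simp: V_max_reflect)
  with profile_reflect[of V c w] that show thesis by simp
qed

text \<open>
  Both parts of the theorem in one: \<open>u0\<close> or \<open>u1\<close> is supercritical exactly if one of the
  end levels \<open>u0 + V 0\<close>, \<open>u1 + V 1\<close> lies above the maximum of \<open>V\<close>.
\<close>
lemma unique_positive_solution_if_endpoint_supercritical:
  assumes V: "C1_01 V" and u: "0 < u0" "0 < u1" and crit: "u0_crit V < u0 \<or> u1_crit V < u1"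
  shows "unique_positive_solution V u0 u1"
proof -
  have "V 0 < u0 + V 0" "V 1 < u1 + V 1" "V_max V < max (u0 + V 0) (u1 + V 1)"
    using u crit by (auto simp: u0_crit_def u1_crit_def less_max_iff_disj)
  then obtain c w where w: "profile V c w" "w 0 = u0 + V 0" "w 1 = u1 + V 1"
    by (rule profile_exists[OF V])
  show ?thesis
    unfolding unique_positive_solution_def
  proof (intro exI[of _ "\<lambda>x. w x - V x"] conjI allI impI ballI)
    show "is_solution V u0 u1 (\<lambda>x. w x - V x)" "strictly_positive (\<lambda>x. w x - V x)"
      using profile_imp_solution[OF V w(1)] w by auto
  next
    fix v x assume v: "is_solution V u0 u1 v \<and> strictly_positive v" and x: "x \<in> {0..1::real}"
    then obtain d where "profile V d (\<lambda>x. v x + V x)"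
      using solution_imp_profile[OF V] by blast
    from profile_unique[OF C1_01_continuous[OF V] this w(1) _ _ x] v w(2,3)
    show "v x = w x - V x"
      by (simp add: is_solution_def)
  qed
qed

theorem theorem11:
  fixes V :: "real \<Rightarrow> real"
  assumes "C1_01 V"
  shows "(\<forall>u0>0. u0 > u0_crit V \<longrightarrow> (\<forall>u1>0. unique_positive_solution V u0 u1))
       \<and> (\<forall>u1>0. u1 > u1_crit V \<longrightarrow> (\<forall>u0>0. unique_positive_solution V u0 u1))"
  using unique_positive_solution_if_endpoint_supercritical[OF assms] by blast

end
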